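(* Consider the cached-file delivery problem $\mathcal{P}1$ described in the context, and let $(\mathbf{X},\boldsymbol{\rho})$ be any optimal solution of $\mathcal{P}1$. Then: (i) For each requested file $f\in\mathcal{F}$, the transmission delays through all established links are equal: there is a number $t_f^*$ such that $\frac{\rho_f(s)\,b_fR_p}{C_f(s)}=t_f^*$ for every $s\in V_f$ with $x_f(s)=1$, and, if $C_f(g)>0$ (the ground station is visible), also $\frac{\rho_f(g)\,b_fR_p}{C_f(g)}=t_f^*$. (ii) For each requested file $f\in\mathcal{F}$, the number of inter-satellite links established by the satellite that aggregates $f$ equals the maximum allowed number or the number of visible satellites that have cached the file, whichever is smaller: $\sum_{s\in V_f}x_f(s)=\min\{N_{\mathrm{ISL},\max},|V_f|\}$.
   Context: Setting: $\mathcal{F}$ is a finite set of requested files. Each file $f$ consists of $b_f>0$ packets of $R_p>0$ bits each, and is to be aggregated at a satellite $s_j$ (depending on $f$), which may download portions of $f$ in parallel over inter-satellite links (ISLs) from other satellites and over one ground-to-space link from its associated ground station $g$. Notation: $V_f$ is the finite set of satellites that are visible to the aggregating satellite of $f$ and have cached $f$. For $s\in V_f$, $C_f(s)>0$ is the fixed achievable rate of the ISL from $s$ to the aggregating satellite. $C_f(g)\ge 0$ is the fixed achievable rate of the ground-to-space link, with $C_f(g)=0$ meaning that no ground station is visible. $N_{\mathrm{ISL},\max}$ is a positive integer, the maximum number of ISLs. Variables, for each $f$: $x_f(s)\in\{0,1\}$ for $s\in V_f$ ($x_f(s)=1$ means the ISL from $s$ is established), $\rho_f(s)\in[0,1]$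 for $s\in V_f$ and $\rho_f(g)\in[0,1]$ (fractions of $f$ downloaded from $s$ and from $g$), where $\rho_f(g)=0$ if $C_f(g)=0$. The transmission delay over the ISL from $s$ is $\rho_f(s)b_fR_p/C_f(s)$, and over the ground-to-space link it is $\rho_f(g)b_fR_p/C_f(g)$ (taken to be $0$ if $C_f(g)=0$). Propagation delays are neglected. Problem $\mathcal{P}1$: minimize over $(\mathbf{X},\boldsymbol{\rho})=\big((x_f(s)),(\rho_f(s),\rho_f(g))\big)$ $$\sum_{f\in\mathcal{F}}\max\Big\{\max_{s\in V_f}x_f(s)\frac{\rho_f(s)b_fR_p}{C_f(s)},\ \frac{\rho_f(g)b_fR_p}{C_f(g)}\Big\}$$ (a maximum over an empty set being $0$), subject to, for every $f\in\mathcal{F}$: $\sum_{s\in V_f}x_f(s)\le N_{\mathrm{ISL},\max}$; $\rho_f(s)\le x_f(s)$ for all $s\in V_f$; $\sum_{s\in V_f}\rho_f(s)+\rho_f(g)=1$; and the range constraints on the variables given above. *)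

theory Defs
  imports Complex_Main
begin

text \<open>
  Files are elements of \<^typ>\<open>'f\<close>, satellites are elements of \<^typ>\<open>'s\<close>. The aggregating satellite of
  a file and its ground station enter only through the data attached to the file, so the
  ground-to-space link is kept apart from the inter-satellite links (ISLs) instead of being
  treated as a further element of the set of caching satellites.
\<close>

record ('f, 's) delivery_problem =
  files :: "'f set"
  packets :: "'f \<Rightarrow> nat"
  packet_bits :: real
  cachers :: "'f \<Rightarrow> 's set"  \<comment> \<open>the visible satellites that have cached the file\<close>
  isl_rate :: "'f \<Rightarrow> 's \<Rightarrow> real"
  ground_rate :: "'f \<Rightarrow> real"  \<comment> \<open>0 if no ground station is visible\<close>
  max_isls :: nat

definition valid_problem :: "('f, 's) delivery_problem \<Rightarrow> bool" where
  "valid_problem P \<longleftrightarrow>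
     finite (files P) \<and> packet_bits P > 0 \<and> max_isls P > 0 \<and>
     (\<forall>f\<in>files P. packets P f > 0 \<and> finite (cachers P f) \<and>
        (\<forall>s\<in>cachers P f. isl_rate P f s > 0) \<and> ground_rate P f \<ge> 0)"

definition isl_delay :: "('f, 's) delivery_problem \<Rightarrow> ('f \<Rightarrow> 's \<Rightarrow> real) \<Rightarrow> 'f \<Rightarrow> 's \<Rightarrow> real" where
  "isl_delay P \<rho> f s = \<rho> f s * real (packets P f) * packet_bits P / isl_rate P f s"

definition ground_delay :: "('f, 's) delivery_problem \<Rightarrow> ('f \<Rightarrow> real) \<Rightarrow> 'f \<Rightarrow> real" where
  "ground_delay P \<rho>g f =
     (if ground_rate P f = 0 then 0
      else \<rho>g f * real (packets P f) * packet_bits P / ground_rate P f)"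

text \<open>\<^const>\<open>Max\<close> is unspecified on the empty set, where the maximum is meant to be 0.\<close>

definition max_or_zero :: "real set \<Rightarrow> real" where
  "max_or_zero A = (if A = {} then 0 else Max A)"

definition total_delay ::
  "('f, 's) delivery_problem \<Rightarrow> ('f \<Rightarrow> 's \<Rightarrow> nat) \<Rightarrow> ('f \<Rightarrow> 's \<Rightarrow> real) \<Rightarrow> ('f \<Rightarrow> real) \<Rightarrow> real" where
  "total_delay P x \<rho> \<rho>g =
     (\<Sum>f\<in>files P.
        max (max_or_zero ((\<lambda>s. real (x f s) * isl_delay P \<rho> f s) ` cachers P f))
            (ground_delay P \<rho>g f))"

text \<open>
  A candidate solution consists of the ISL indicators \<open>x\<close>, the fractions \<open>\<rho>\<close> downloaded over the
  ISLs and the fractions \<open>\<rho>g\<close> downloaded over the ground-to-space links. Their values at other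
  arguments than \<open>f \<in> files P\<close> and \<open>s \<in> cachers P f\<close> are irrelevant.
\<close>

definition feasible ::
  "('f, 's) delivery_problem \<Rightarrow> ('f \<Rightarrow> 's \<Rightarrow> nat) \<Rightarrow> ('f \<Rightarrow> 's \<Rightarrow> real) \<Rightarrow> ('f \<Rightarrow> real) \<Rightarrow> bool" where
  "feasible P x \<rho> \<rho>g \<longleftrightarrow>
     (\<forall>f\<in>files P.
        (\<forall>s\<in>cachers P f. x f s \<in> {0, 1} \<and> \<rho> f s \<in> {0..1} \<and> \<rho> f s \<le> real (x f s)) \<and>
        \<rho>g f \<in> {0..1} \<and> (ground_rate P f = 0 \<longrightarrow> \<rho>g f = 0) \<and>
        (\<Sum>s\<in>cachers P f. x f s) \<le> max_isls P \<and>
        (\<Sum>s\<in>cachers P f. \<rho> f s) + \<rho>g f = 1)"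

definition optimal ::
  "('f, 's) delivery_problem \<Rightarrow> ('f \<Rightarrow> 's \<Rightarrow> nat) \<Rightarrow> ('f \<Rightarrow> 's \<Rightarrow> real) \<Rightarrow> ('f \<Rightarrow> real) \<Rightarrow> bool" where
  "optimal P x \<rho> \<rho>g \<longleftrightarrow>
     feasible P x \<rho> \<rho>g \<and>
     (\<forall>x' \<rho>' \<rho>g'. feasible P x' \<rho>' \<rho>g' \<longrightarrow> total_delay P x \<rho> \<rho>g \<le> total_delay P x' \<rho>' \<rho>g')"

end

theory Submission imports Defs begin

text \<open>
  Fix a file of total size \<open>K\<close> bits, and let \<open>C\<close> be the sum of the rates of its established links.
  Every link delay is at most the delay \<open>D\<close> of the file, so \<open>K \<le> D * C\<close>, with equality only if all
  links have delay \<open>D\<close>. Conversely, dividing the file over any admissible set of links in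
  proportion to their rates achieves the delay \<open>K / C\<close>. Hence an optimal solution has equal delays
  and \<open>D = K / C\<close>, and an additional link would strictly decrease this.
\<close>

definition file_size :: "('f, 's) delivery_problem \<Rightarrow> 'f \<Rightarrow> real" where
  "file_size P f = real (packets P f) * packet_bits P"

text \<open>The summand of \<open>total_delay\<close>, named so that optimality can be studied one
  file at a time.\<close>

definition file_delay ::
  "('f, 's) delivery_problem \<Rightarrow> ('f \<Rightarrow> 's \<Rightarrow> nat) \<Rightarrow> ('f \<Rightarrow> 's \<Rightarrow> real) \<Rightarrow> ('f \<Rightarrow> real) \<Rightarrow> 'f \<Rightarrow> real" where
  "file_delay P x \<rho> \<rho>g f =
     max (max_or_zero ((\<lambda>s. real (x f s) * isl_delay P \<rho> f s) ` cachers P f)) (ground_delay P \<rho>g f)"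

definition established ::
  "('f, 's) delivery_problem \<Rightarrow> ('f \<Rightarrow> 's \<Rightarrow> nat) \<Rightarrow> 'f \<Rightarrow> 's set" where
  "established P x f = {s \<in> cachers P f. x f s = 1}"

text \<open>The ground link is always counted: it uses up no ISL, and an invisible ground station
  has rate 0.\<close>

definition total_rate :: "('f, 's) delivery_problem \<Rightarrow> 'f \<Rightarrow> 's set \<Rightarrow> real" where
  "total_rate P f A = (\<Sum>s\<in>A. isl_rate P f s) + ground_rate P f"

lemma max_or_zero_ge: "finite A \<Longrightarrow> a \<in> A \<Longrightarrow> a \<le> max_or_zero A"
  unfolding max_or_zero_def by auto

text \<open>The premise \<open>0 \<le> b\<close> takes care of the empty set, whose maximum is set
  to 0.\<close>

lemma max_or_zero_le: "finite A \<Longrightarrow> 0 \<le> b \<Longrightarrow> (\<And>a. a \<in> A \<Longrightarrow> a \<le> b) \<Longrightarrow> max_or_zero A \<le> b"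
  unfolding max_or_zero_def by auto

lemma valid_problemD:
  assumes "valid_problem P" "f \<in> files P"
  shows "finite (files P)" "finite (cachers P f)" "file_size P f > 0" "ground_rate P f \<ge> 0"
    "\<And>s. s \<in> cachers P f \<Longrightarrow> isl_rate P f s > 0"
  using assms unfolding valid_problem_def file_size_def by auto

text \<open>The constraint \<open>\<rho> f s \<le> real (x f s)\<close> forces the fraction to 0
  wherever no link is established, so both sums collapse to the established links.\<close>

lemma feasible_sums:
  assumes "valid_problem P" "feasible P x \<rho> \<rho>g" "f \<in> files P"
  shows "(\<Sum>s\<in>cachers P f. x f s) = card (established P x f)"
    and "(\<Sum>s\<in>established P x f. \<rho> f s) + \<rho>g f = 1"
proof -
  have fin: "finite (cachers P f)"
    using valid_problemD[OF assms(1,3)] by simp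
  have x: "x f s \<in> {0, 1}" "\<rho> f s \<in> {0..1}" "\<rho> f s \<le> real (x f s)" if "s \<in> cachers P f" for s
    using assms(2,3) that unfolding feasible_def by auto
  have sub: "established P x f \<subseteq> cachers P f"
    unfolding established_def by auto
  have zero: "x f s = 0" if "s \<in> cachers P f - established P x f" for s
    using x(1)[of s] that unfolding established_def by auto
  have "(\<Sum>s\<in>cachers P f. x f s) = (\<Sum>s\<in>established P x f. x f s)"
    using fin sub zero by (intro sum.mono_neutral_right) auto
  also have "\<dots> = (\<Sum>s\<in>established P x f. 1)"
    by (rule sum.cong) (auto simp: established_def)
  finally show "(\<Sum>s\<in>cachers P f. x f s) = card (established P x f)"
    by simp
  have "(\<Sum>s\<in>cachers P f. \<rho> f s) = (\<Sum>s\<in>established P x f. \<rho> f s)"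
    using fin sub zero x by (intro sum.mono_neutral_right) force+
  then show "(\<Sum>s\<in>established P x f. \<rho> f s) + \<rho>g f = 1"
    using assms(2,3) unfolding feasible_def by auto
qed

lemma isl_delay_le_file_delay:
  assumes "finite (cachers P f)" "s \<in> established P x f"
  shows "isl_delay P \<rho> f s \<le> file_delay P x \<rho> \<rho>g f"
proof -
  have "real (x f s) * isl_delay P \<rho> f s
      \<le> max_or_zero ((\<lambda>s. real (x f s) * isl_delay P \<rho> f s) ` cachers P f)"
    using assms by (intro max_or_zero_ge finite_imageI imageI) (auto simp: established_def)
  then show ?thesis
    using assms(2) unfolding file_delay_def established_def by auto
qed

text \<open>The given solution is compared with one that differs only at \<open>f\<close>, where the
  links of \<open>A\<close> and the ground link carry shares proportional to their rates. Positivity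
  of the total rate rules out the case without any link, in which the shares would be
  undefined.\<close>

lemma optimal_file_delay_le:
  assumes valid: "valid_problem P" and opt: "optimal P x \<rho> \<rho>g" and f: "f \<in> files P"
    and A: "A \<subseteq> cachers P f" "card A \<le> max_isls P" and pos: "total_rate P f A > 0"
  shows "file_delay P x \<rho> \<rho>g f \<le> file_size P f / total_rate P f A"
proof -
  note v = valid_problemD[OF valid f]
  define C where "C = total_rate P f A"
  define x' where "x' = x(f := \<lambda>s. if s \<in> A then 1 else 0)"
  define \<rho>' where "\<rho>' = \<rho>(f := \<lambda>s. if s \<in> A then isl_rate P f s / C else 0)"
  define \<rho>g' where "\<rho>g' = \<rho>g(f := ground_rate P f / C)"
  have C: "C > 0"
    using pos by (simp add: C_def)
  have fin: "finite A"
    using A(1) v(2) by (rule finite_subset)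
  have rate_nonneg: "isl_rate P f s \<ge> 0" if "s \<in> A" for s
    using A(1) v(5)[of s] that by auto
  \<comment> \<open>Bounding each single rate by \<open>C\<close> keeps the new fractions at most
    1.\<close>
  have rate_le: "isl_rate P f s \<le> C" if "s \<in> A" for s
  proof -
    have "isl_rate P f s \<le> (\<Sum>s\<in>A. isl_rate P f s)"
      using rate_nonneg fin that by (intro member_le_sum) auto
    then show ?thesis
      using v(4) unfolding C_def total_rate_def by simp
  qed
  have ground_le: "ground_rate P f \<le> C"
    unfolding C_def total_rate_def using rate_nonneg by (simp add: sum_nonneg)
  \<comment> \<open>The value type is left general because this serves the real fractions as well as
    the natural-number indicators.\<close>
  have restrict: "(\<Sum>s\<in>cachers P f. if s \<in> A then h s else 0) = (\<Sum>s\<in>A. h s)"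
    for h :: "'b \<Rightarrow> 'c::comm_monoid_add"
    using A(1) v(2) by (simp add: sum.If_cases Int_absorb1)
  have "(\<Sum>s\<in>A. isl_rate P f s / C) + ground_rate P f / C = 1"
    using C unfolding C_def total_rate_def
    by (simp add: sum_divide_distrib[symmetric] add_divide_distrib[symmetric])
  then have sum_1: "(\<Sum>s\<in>cachers P f. \<rho>' f s) + \<rho>g' f = 1"
    by (simp add: \<rho>'_def \<rho>g'_def restrict)
  have sum_x: "(\<Sum>s\<in>cachers P f. x' f s) \<le> max_isls P"
    using A(2) by (simp add: x'_def restrict)
  have feas': "feasible P x' \<rho>' \<rho>g'"
    unfolding feasible_def
  proof (rule ballI, goal_cases)
    case (1 h)
    show ?case
    proof (cases "h = f")
      case True
      then show ?thesis
        using sum_1 sum_x C v(4) ground_le rate_le rate_nonneg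
        by (auto simp: x'_def \<rho>'_def \<rho>g'_def)
    next
      case False
      then show ?thesis
        using 1 opt unfolding optimal_def feasible_def x'_def \<rho>'_def \<rho>g'_def by auto
    qed
  qed
  have delay': "file_delay P x' \<rho>' \<rho>g' f \<le> file_size P f / C"
  proof -
    have "isl_delay P \<rho>' f s = file_size P f / C" if "s \<in> A" for s
      using that A(1) v(5)[of s]
      by (auto simp: isl_delay_def \<rho>'_def file_size_def)
    \<comment> \<open>The maximum also ranges over zeros, from satellites outside \<open>A\<close>,
      from an empty set of cachers or from an invisible ground station.\<close>
    moreover have "0 \<le> file_size P f / C"
      using v(3) C by simp
    ultimately show ?thesis
      using v(2) unfolding file_delay_def
      by (auto intro!: max_or_zero_le simp: x'_def ground_delay_def \<rho>g'_def file_size_def)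
  qed
  have "(\<Sum>h\<in>files P. file_delay P x \<rho> \<rho>g h) \<le> (\<Sum>h\<in>files P. file_delay P x' \<rho>' \<rho>g' h)"
    using opt feas' unfolding optimal_def total_delay_def file_delay_def by blast
  \<comment> \<open>The other files keep their variables, so their summands cancel and the global
    comparison becomes one for \<open>f\<close> alone.\<close>
  moreover have "(\<Sum>h\<in>files P - {f}. file_delay P x \<rho> \<rho>g h)
      = (\<Sum>h\<in>files P - {f}. file_delay P x' \<rho>' \<rho>g' h)"
    by (rule sum.cong)
      (auto simp: file_delay_def isl_delay_def ground_delay_def x'_def \<rho>'_def \<rho>g'_def)
  ultimately have "file_delay P x \<rho> \<rho>g f \<le> file_delay P x' \<rho>' \<rho>g' f"
    using v(1) f by (simp add: sum.remove)
  then show ?thesis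
    using delay' by (simp add: C_def)
qed

lemma optimal_equal_delays:
  assumes valid: "valid_problem P" and opt: "optimal P x \<rho> \<rho>g" and f: "f \<in> files P"
  defines "A \<equiv> established P x f" and "D \<equiv> file_delay P x \<rho> \<rho>g f"
  shows "\<And>s. s \<in> A \<Longrightarrow> isl_delay P \<rho> f s = D"
    and "ground_rate P f > 0 \<Longrightarrow> ground_delay P \<rho>g f = D"
    and "total_rate P f A > 0"
    and "D = file_size P f / total_rate P f A"
proof -
  note v = valid_problemD[OF valid f]
  define K where "K = file_size P f"
  have feas: "feasible P x \<rho> \<rho>g"
    using opt by (simp add: optimal_def)
  note sums = feasible_sums[OF valid feas f, folded A_def]
  have A: "A \<subseteq> cachers P f"
    by (auto simp: A_def established_def)
  have finA: "finite A"
    using A v(2) by (rule finite_subset)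
  have K: "K > 0"
    using v(3) by (simp add: K_def)
  have rate: "isl_rate P f s > 0" if "s \<in> A" for s
    using A v(5) that by auto
  have isl: "isl_delay P \<rho> f s = K * \<rho> f s / isl_rate P f s" for s
    by (simp add: isl_delay_def K_def file_size_def)
  have ground: "ground_delay P \<rho>g f = K * \<rho>g f / ground_rate P f" if "ground_rate P f > 0"
    using that by (simp add: ground_delay_def K_def file_size_def)
  \<comment> \<open>In time \<open>D\<close> a link could carry \<open>D\<close> times its rate; the
    slack is the capacity left over. It vanishes exactly when the link delay is
    \<open>D\<close>.\<close>
  have slack_isl: "0 \<le> D * isl_rate P f s - K * \<rho> f s" if "s \<in> A" for s
    using isl_delay_le_file_delay[of P f s x \<rho> \<rho>g] v(2) that rate[OF that]
    unfolding isl A_def D_def by (simp add: pos_divide_le_eq)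
  have slack_ground: "0 \<le> D * ground_rate P f - K * \<rho>g f"
  proof (cases "ground_rate P f = 0")
    \<comment> \<open>Without a visible ground station feasibility gives
      \<open>\<rho>g f = 0\<close>, so the slack is 0.\<close>
    case True
    then show ?thesis
      using feas f by (auto simp: feasible_def)
  next
    case False
    then have g: "ground_rate P f > 0"
      using v(4) by simp
    have "ground_delay P \<rho>g f \<le> D"
      by (simp add: D_def file_delay_def)
    then show ?thesis
      using g by (simp add: ground pos_divide_le_eq)
  qed
  have "K * (\<Sum>s\<in>A. \<rho> f s) + K * \<rho>g f = K"
    using sums(2) by (metis distrib_left mult.right_neutral)
  then have slack: "(\<Sum>s\<in>A. D * isl_rate P f s - K * \<rho> f s)
      + (D * ground_rate P f - K * \<rho>g f) = D * total_rate P f A - K"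
    by (simp add: total_rate_def sum_subtractf sum_distrib_left algebra_simps)
  \<comment> \<open>Since \<open>K > 0\<close>, this bound excludes a total rate of 0; only then can
    the upper bound on \<open>D\<close> be applied to \<open>A\<close> itself.\<close>
  have "K \<le> D * total_rate P f A"
    using slack slack_ground sum_nonneg[OF slack_isl, of A "\<lambda>s. s"] by simp
  moreover have "total_rate P f A \<ge> 0"
    unfolding total_rate_def using v(4) rate by (simp add: sum_nonneg less_imp_le)
  ultimately show rate_pos: "total_rate P f A > 0"
    using K by (cases "total_rate P f A = 0") auto
  have "card A \<le> max_isls P"
    using sums(1) feas f by (auto simp: feasible_def)
  then have "D \<le> K / total_rate P f A"
    unfolding D_def K_def by (rule optimal_file_delay_le[OF valid opt f A _ rate_pos])
  then have "D * total_rate P f A \<le> K"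
    using rate_pos by (simp add: pos_le_divide_eq)
  \<comment> \<open>The slacks are nonnegative and their sum is now at most 0, so all of them
    vanish.\<close>
  with slack slack_ground sum_nonneg[OF slack_isl, of A "\<lambda>s. s"]
  have tight: "(\<Sum>s\<in>A. D * isl_rate P f s - K * \<rho> f s) = 0"
    "D * ground_rate P f - K * \<rho>g f = 0" "D * total_rate P f A = K"
    by simp_all
  show "isl_delay P \<rho> f s = D" if "s \<in> A" for s
  proof -
    have "D * isl_rate P f s - K * \<rho> f s = 0"
      using tight(1) sum_nonneg_eq_0_iff[OF finA slack_isl] that by simp
    then show ?thesis
      using rate[OF that] by (simp add: isl field_simps)
  qed
  show "ground_delay P \<rho>g f = D" if "ground_rate P f > 0"
    using tight(2) that by (simp add: ground field_simps)
  show "D = file_size P f / total_rate P f A"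
    using tight(3) rate_pos unfolding K_def by (simp add: field_simps)
qed

lemma optimal_card_established:
  assumes valid: "valid_problem P" and opt: "optimal P x \<rho> \<rho>g" and f: "f \<in> files P"
  shows "card (established P x f) = min (max_isls P) (card (cachers P f))"
proof (rule ccontr)
  note v = valid_problemD[OF valid f]
  let ?A = "established P x f"
  assume neq: "card ?A \<noteq> min (max_isls P) (card (cachers P f))"
  have feas: "feasible P x \<rho> \<rho>g"
    using opt by (simp add: optimal_def)
  have A: "?A \<subseteq> cachers P f"
    by (auto simp: established_def)
  have finA: "finite ?A"
    using A v(2) by (rule finite_subset)
  have "card ?A \<le> max_isls P"
    using feasible_sums(1)[OF valid feas f] feas f by (auto simp: feasible_def)
  moreover have "card ?A \<le> card (cachers P f)"
    using v(2) A by (rule card_mono)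
  ultimately have less: "card ?A < max_isls P" "card ?A < card (cachers P f)"
    using neq by auto
  then obtain s where s: "s \<in> cachers P f" "s \<notin> ?A"
    using A by (metis less_irrefl subsetI subset_antisym)
  note tight = optimal_equal_delays(3,4)[OF valid opt f]
  have more: "total_rate P f (insert s ?A) > total_rate P f ?A"
    using s v(5) finA by (simp add: total_rate_def)
  have "file_delay P x \<rho> \<rho>g f \<le> file_size P f / total_rate P f (insert s ?A)"
    using A s finA less(1) tight(1) more
    by (intro optimal_file_delay_le[OF valid opt f]) auto
  also have "\<dots> < file_size P f / total_rate P f ?A"
    using v(3) tight(1) more by (simp add: divide_strict_left_mono)
  finally show False
    using tight(2) by simp
qed

theorem lemma1:
  fixes P :: "('f, 's) delivery_problem"
    and x :: "'f \<Rightarrow> 's \<Rightarrow> nat"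
    and \<rho> :: "'f \<Rightarrow> 's \<Rightarrow> real"
    and \<rho>g :: "'f \<Rightarrow> real"
  assumes "valid_problem P"
    and "optimal P x \<rho> \<rho>g"
  shows "(\<forall>f\<in>files P. \<exists>t.
            (\<forall>s\<in>cachers P f. x f s = 1 \<longrightarrow> isl_delay P \<rho> f s = t) \<and>
            (ground_rate P f > 0 \<longrightarrow> ground_delay P \<rho>g f = t)) \<and>
         (\<forall>f\<in>files P. (\<Sum>s\<in>cachers P f. x f s) = min (max_isls P) (card (cachers P f)))"
proof (intro conjI ballI)
  fix f assume f: "f \<in> files P"
  \<comment> \<open>The common value is \<open>file_delay P x \<rho> \<rho>g f\<close>.\<close>
  show "\<exists>t. (\<forall>s\<in>cachers P f. x f s = 1 \<longrightarrow> isl_delay P \<rho> f s = t) \<and>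
            (ground_rate P f > 0 \<longrightarrow> ground_delay P \<rho>g f = t)"
    using optimal_equal_delays(1,2)[OF assms f] by (auto simp: established_def)
  have "feasible P x \<rho> \<rho>g"
    using assms(2) by (simp add: optimal_def)
  then show "(\<Sum>s\<in>cachers P f. x f s) = min (max_isls P) (card (cachers P f))"
    using feasible_sums(1) optimal_card_established assms f by metis
qed

end
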